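(* Let $G$ be a finite, simple, connected, undirected graph and let $c(G)$ cops, starting from any initial positions, each perform a random walk on $G$ (in each round moving to a neighbour of its current vertex chosen uniformly at random, independently), while the robber, starting from any vertex, uses any strategy to try to avoid capture. Let $T$ be the capture time. Then $\mathbb{E}T<\infty$.
   Context: Cops and robber game on $G$: in each round first the cops move, then the robber moves (the robber may move along an edge or stay put). The capture time $T$ is the first time some cop occupies the same vertex as the robber. The cop number $c(G)$ is the minimum number of cops that have a strategy guaranteeing capture of a robber who sees all positions and plays optimally.
   Formalization: Here c(G) is the least number of cops who, obliged to move along an edge every round, can force capture from every initial placement; with the usual c(G) the claim fails on K_{3,3} (c=2) when both walkers start in the robber's class. *)

theory Defs
  imports
    "HOL-Probability.Probability"
    "Graph_Theory.Graph_Theory"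
begin

text \<open>
  A finite simple undirected graph is a symmetric digraph in the sense of the locale
  \<^locale>\<open>graph\<close> (finite, no loops, no parallel arcs, every arc has its reverse).
  The cops are numbered \<open>0, \<dots>, k - 1\<close>; a placement of them is a function on \<^typ>\<open>nat\<close>
  of which only the values below \<open>k\<close> matter.

  Movement convention: the cops of the game and the randomly walking cops obey the same rule.
  A cop moves along an edge in every round, whereas the robber may also stay put.
  An isolated vertex (in a connected graph, only the one-vertex graph has one) offers
  no edge, so there a cop stays.
\<close>

definition cop_moves :: "('a, 'b) pre_digraph \<Rightarrow> 'a \<Rightarrow> 'a set" where
  "cop_moves G v = (let N = {u. v \<rightarrow>\<^bsub>G\<^esub> u} in if N = {} then {v} else N)"

definition robber_moves :: "('a, 'b) pre_digraph \<Rightarrow> 'a \<Rightarrow> 'a set" where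
  "robber_moves G v = insert v {u. v \<rightarrow>\<^bsub>G\<^esub> u}"

text \<open>
  \<open>c t\<close> and \<open>r t\<close> are the positions at the end of round \<open>t\<close>, round \<open>0\<close> being the initial
  placement. Round \<open>t + 1\<close> begins with the cops' move, so capture occurs in it if a cop
  steps on \<open>r t\<close>, or if the robber then moves onto a cop.
\<close>

definition captured_in_round ::
    "nat \<Rightarrow> (nat \<Rightarrow> nat \<Rightarrow> 'a) \<Rightarrow> (nat \<Rightarrow> 'a) \<Rightarrow> nat \<Rightarrow> bool" where
  "captured_in_round k c r t \<longleftrightarrow>
     (\<exists>i<k. c t i = r t \<or> (\<exists>s. t = Suc s \<and> c t i = r s))"

definition capture_time ::
    "nat \<Rightarrow> (nat \<Rightarrow> nat \<Rightarrow> 'a) \<Rightarrow> (nat \<Rightarrow> 'a) \<Rightarrow> enat" where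
  "capture_time k c r = (INF t \<in> {t. captured_in_round k c r t}. enat t)"

text \<open>
  A cop strategy maps the history (the list of all configurations from the initial one to the
  current one) to the cops' next placement.
\<close>

type_synonym 'a cop_strategy = "((nat \<Rightarrow> 'a) \<times> 'a) list \<Rightarrow> nat \<Rightarrow> 'a"

definition legal_cop_strategy ::
    "('a, 'b) pre_digraph \<Rightarrow> nat \<Rightarrow> 'a cop_strategy \<Rightarrow> bool" where
  "legal_cop_strategy G k S \<longleftrightarrow>
     (\<forall>h. h \<noteq> [] \<longrightarrow> (\<forall>i<k. fst (last h) i \<in> verts G \<longrightarrow> S h i \<in> cop_moves G (fst (last h) i)))"

definition play_against ::
    "('a, 'b) pre_digraph \<Rightarrow> nat \<Rightarrow> 'a cop_strategy \<Rightarrow> (nat \<Rightarrow> nat \<Rightarrow> 'a) \<Rightarrow> (nat \<Rightarrow> 'a) \<Rightarrow> bool" where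
  "play_against G k S c r \<longleftrightarrow>
     (\<forall>i<k. c 0 i \<in> verts G) \<and> r 0 \<in> verts G \<and>
     (\<forall>t. c (Suc t) = S (map (\<lambda>s. (c s, r s)) [0..<Suc t])) \<and>
     (\<forall>t. r (Suc t) \<in> robber_moves G (r t))"

text \<open>
  The robber who sees everything and plays optimally is rendered by quantifying over all
  robber trajectories. The initial placement is part of the play, hence arbitrary: the
  strategy has to succeed from every initial placement. Together with the
  obligation to move, this is essential on bipartite graphs, where a walking cop can never
  change the parity class it was put into: in \<open>K\<^sub>3\<^sub>,\<^sub>3\<close> two walking cops that start in the same
  class never catch a careful robber, although two cops suffice if they may choose their
  starting vertices or stay put. If cops may stay put, a connected graph has the same cop
  number whether the cops choose their starting vertices or not.
\<close>

definition cops_win :: "('a, 'b) pre_digraph \<Rightarrow> nat \<Rightarrow> bool" where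
  "cops_win G k \<longleftrightarrow>
     (\<exists>S. legal_cop_strategy G k S \<and>
          (\<forall>c r. play_against G k S c r \<longrightarrow> (\<exists>t. captured_in_round k c r t)))"

definition cop_number :: "('a, 'b) pre_digraph \<Rightarrow> nat" where
  "cop_number G = (LEAST k. cops_win G k)"

definition walk_step :: "('a, 'b) pre_digraph \<Rightarrow> 'a \<Rightarrow> 'a pmf" where
  "walk_step G v = pmf_of_set (cop_moves G v)"

text \<open>
  \<open>X t i\<close> is the position of cop \<open>i\<close> and \<open>R t\<close> that of the robber at the end of round \<open>t\<close>.
  Conditionally on the whole past of cops and robber, the cops' steps are
  independent and uniform; the last clause says this with the conditional probability
  multiplied out. This clause is the only restriction on the robber besides
  the legality of his moves: he moves after the cops, so \<open>R t\<close> may depend in any way,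
  deterministic or randomized, on everything up to and including the cops' move of round \<open>t\<close>,
  but it cannot anticipate later cop moves.
\<close>

definition random_walking_cops ::
    "('a, 'b) pre_digraph \<Rightarrow> nat \<Rightarrow> (nat \<Rightarrow> 'a) \<Rightarrow> 'w measure \<Rightarrow>
     (nat \<Rightarrow> nat \<Rightarrow> 'w \<Rightarrow> 'a) \<Rightarrow> (nat \<Rightarrow> 'w \<Rightarrow> 'a) \<Rightarrow> bool" where
  "random_walking_cops G k x0 M X R \<longleftrightarrow>
     (\<forall>t. \<forall>i<k. X t i \<in> M \<rightarrow>\<^sub>M count_space UNIV) \<and>
     (\<forall>t. R t \<in> M \<rightarrow>\<^sub>M count_space UNIV) \<and>
     (\<forall>\<omega>\<in>space M. \<forall>i<k. X 0 i \<omega> = x0 i) \<and>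
     (\<forall>t x r y.
        measure M {\<omega> \<in> space M. (\<forall>s\<le>t. (\<forall>i<k. X s i \<omega> = x s i) \<and> R s \<omega> = r s) \<and>
                                (\<forall>i<k. X (Suc t) i \<omega> = y i)}
        = measure M {\<omega> \<in> space M. \<forall>s\<le>t. (\<forall>i<k. X s i \<omega> = x s i) \<and> R s \<omega> = r s}
          * (\<Prod>i<k. pmf (walk_step G (x t i)) (y i)))"

definition legal_robber ::
    "('a, 'b) pre_digraph \<Rightarrow> 'w measure \<Rightarrow> (nat \<Rightarrow> 'w \<Rightarrow> 'a) \<Rightarrow> bool" where
  "legal_robber G M R \<longleftrightarrow>
     (\<forall>\<omega>\<in>space M. R 0 \<omega> \<in> verts G \<and> (\<forall>t. R (Suc t) \<omega> \<in> robber_moves G (R t \<omega>)))"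

end

theory Submission
  imports Defs
begin

text \<open>
  Call a configuration winning within \<open>n\<close> rounds if the cops can force capture within \<open>n\<close> rounds
  by backward induction. A robber in a configuration that is winning within no \<open>n\<close> always has a
  reply leading to another such configuration (he has finitely many replies), so he escapes every
  strategy. Hence if \<open>k\<close> cops win, all of the finitely many configurations are winning within a
  common \<open>N\<close>. Whatever the past, the walking cops make any prescribed joint move with probability
  at least \<open>(1/|V|)\<^sup>k\<close>, so they play the winning moves for the next \<open>N\<close> rounds with probability
  bounded below; the survival probability thus decays geometrically and is summable.
\<close>


section \<open>The pursuit game by backward induction\<close>

text \<open>Capture by stepping on the robber is tested before his reply; his moving onto a cop is a
  capture in the configuration after it. Joint moves are extensional functions, so only finitely
  many placements occur.\<close>

primrec catches_within ::
    "('a, 'b) pre_digraph \<Rightarrow> nat \<Rightarrow> nat \<Rightarrow> (nat \<Rightarrow> 'a) \<Rightarrow> 'a \<Rightarrow> bool" where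
  "catches_within G k 0 c r \<longleftrightarrow> (\<exists>i<k. c i = r)"
| "catches_within G k (Suc n) c r \<longleftrightarrow>
     (\<exists>i<k. c i = r) \<or>
     (\<exists>c'\<in>Pi\<^sub>E {..<k} (\<lambda>i. cop_moves G (c i)).
        (\<exists>i<k. c' i = r) \<or> (\<forall>r'\<in>robber_moves G r. catches_within G k n c' r'))"

lemma catches_within_mono:
  assumes "m \<le> n" "catches_within G k m c r"
  shows "catches_within G k n c r"
proof -
  have "catches_within G k n c r \<Longrightarrow> catches_within G k (Suc n) c r" for n c r
  proof (induction n arbitrary: c r)
    case (Suc n)
    consider "\<exists>i<k. c i = r"
      | c' where "c' \<in> Pi\<^sub>E {..<k} (\<lambda>i. cop_moves G (c i))"
          "(\<exists>i<k. c' i = r) \<or> (\<forall>r'\<in>robber_moves G r. catches_within G k n c' r')"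
      using Suc.prems by auto
    then show ?case
    proof cases
      case 2
      then have "(\<exists>i<k. c' i = r) \<or> (\<forall>r'\<in>robber_moves G r. catches_within G k (Suc n) c' r')"
        using Suc.IH by blast
      with 2(1) show ?thesis
        unfolding catches_within.simps(2)[of G k "Suc n"] by blast
    qed simp
  qed simp
  then show ?thesis
    using assms lift_Suc_mono_le[of "\<lambda>n. catches_within G k n c r" m n] by (simp add: le_bool_def)
qed

context graph
begin

lemma cop_moves_nonempty: "cop_moves G v \<noteq> {}"
  by (simp add: cop_moves_def Let_def)

lemma cop_moves_subset: "v \<in> verts G \<Longrightarrow> cop_moves G v \<subseteq> verts G"
  by (auto simp: cop_moves_def Let_def adj_in_verts split: if_splits)

lemma finite_cop_moves: "v \<in> verts G \<Longrightarrow> finite (cop_moves G v)"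
  using cop_moves_subset finite_subset finite_verts by metis

lemma robber_moves_subset: "v \<in> verts G \<Longrightarrow> robber_moves G v \<subseteq> verts G"
  by (auto simp: robber_moves_def adj_in_verts)

text \<open>If every reply lost for the robber, the maximum of the finitely many bounds would serve
  for all replies at once, and one more round would make the present configuration winning.\<close>

lemma robber_escapes:
  assumes "r \<in> verts G" and "\<And>n. \<not> catches_within G k n c r"
    and "c' \<in> Pi\<^sub>E {..<k} (\<lambda>i. cop_moves G (c i))"
  shows "\<forall>i<k. c' i \<noteq> r" and "\<exists>r'\<in>robber_moves G r. \<forall>n. \<not> catches_within G k n c' r'"
proof -
  show "\<forall>i<k. c' i \<noteq> r"
    using assms(2)[of "Suc 0"] assms(3) by auto
  show "\<exists>r'\<in>robber_moves G r. \<forall>n. \<not> catches_within G k n c' r'"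
  proof (rule ccontr)
    assume "\<not> ?thesis"
    then obtain f where f: "\<And>r'. r' \<in> robber_moves G r \<Longrightarrow> catches_within G k (f r') c' r'"
      by metis
    have fin: "finite (robber_moves G r)"
      using robber_moves_subset[OF assms(1)] finite_subset finite_verts by blast
    have "catches_within G k (Max (f ` robber_moves G r)) c' r'" if "r' \<in> robber_moves G r" for r'
      using catches_within_mono[OF _ f[OF that]] fin that by simp
    then have "catches_within G k (Suc (Max (f ` robber_moves G r))) c r"
      unfolding catches_within.simps(2) using assms(3) by blast
    then show False
      using assms(2) by blast
  qed
qed

text \<open>The contrapositive is a determinacy argument: from a configuration winning within no
  \<open>n\<close>, a robber who keeps choosing replies of that kind defeats any given strategy
  \<open>S\<close>.\<close>

lemma cops_win_imp_catches_within:
  assumes "cops_win G k" and c0: "c0 \<in> Pi\<^sub>E {..<k} (\<lambda>_. verts G)" and r0: "r0 \<in> verts G"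
  shows "\<exists>n. catches_within G k n c0 r0"
proof (rule ccontr)
  assume safe0: "\<not> ?thesis"
  obtain S where S: "legal_cop_strategy G k S"
    and win: "\<And>c r. play_against G k S c r \<Longrightarrow> \<exists>t. captured_in_round k c r t"
    using assms(1) unfolding cops_win_def by blast
  \<comment> \<open>The values of \<open>S\<close> at indices from \<open>k\<close> on are
    arbitrary, whereas \<open>catches_within\<close> moves extensional placements; hence the
    restriction.\<close>
  define safe where
    "safe c r \<longleftrightarrow> r \<in> verts G \<and> (\<forall>i<k. c i \<in> verts G)
       \<and> (\<forall>n. \<not> catches_within G k n (restrict c {..<k}) r)" for c r
  define reply where
    "reply c r = (SOME r'. r' \<in> robber_moves G r \<and> safe c r')" for c :: "nat \<Rightarrow> 'a" and r
  \<comment> \<open>\<open>S\<close> reads the whole history, so the recursion builds the list of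
    configurations; \<open>c\<close> and \<open>r\<close> are read off its last entry.\<close>
  define hist where
    "hist t = rec_nat [(c0, r0)] (\<lambda>_ h. h @ [(S h, reply (S h) (snd (last h)))]) t" for t :: nat
  define c where "c t = fst (last (hist t))" for t
  define r where "r t = snd (last (hist t))" for t
  have hist: "hist t = map (\<lambda>s. (c s, r s)) [0..<Suc t]" for t
    by (induction t) (simp_all add: hist_def c_def r_def)
  have c_Suc: "c (Suc t) = S (hist t)" and r_Suc: "r (Suc t) = reply (c (Suc t)) (r t)" for t
    by (simp_all add: hist_def c_def r_def)
  have step: "r (Suc t) \<in> robber_moves G (r t) \<and> safe (c (Suc t)) (r (Suc t))
      \<and> (\<forall>i<k. c (Suc t) i \<noteq> r t)" if "safe (c t) (r t)" for t
  proof -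
    have "hist t \<noteq> []" "last (hist t) = (c t, r t)"
      using hist[of t] by simp_all
    then have mv: "c (Suc t) i \<in> cop_moves G (c t i)" if "i < k" for i
      using S \<open>safe (c t) (r t)\<close> that unfolding legal_cop_strategy_def c_Suc safe_def by auto
    have V: "c (Suc t) i \<in> verts G" if "i < k" for i
      using mv[OF that] cop_moves_subset that \<open>safe (c t) (r t)\<close> unfolding safe_def by blast
    have mv': "restrict (c (Suc t)) {..<k} \<in> Pi\<^sub>E {..<k} (\<lambda>i. cop_moves G (restrict (c t) {..<k} i))"
      using mv by auto
    have "r t \<in> verts G" "\<And>n. \<not> catches_within G k n (restrict (c t) {..<k}) (r t)"
      using that unfolding safe_def by blast+
    note esc = robber_escapes[OF this mv']
    have "\<exists>r'. r' \<in> robber_moves G (r t) \<and> safe (c (Suc t)) r'"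
      using esc(2) V robber_moves_subset[OF \<open>r t \<in> verts G\<close>] unfolding safe_def by blast
    from someI_ex[OF this] have "r (Suc t) \<in> robber_moves G (r t) \<and> safe (c (Suc t)) (r (Suc t))"
      unfolding r_Suc reply_def .
    moreover have "\<forall>i<k. c (Suc t) i \<noteq> r t"
      using esc(1) by simp
    ultimately show ?thesis by blast
  qed
  have c00: "c 0 = c0" "r 0 = r0"
    by (simp_all add: c_def r_def hist_def)
  have "restrict c0 {..<k} = c0"
    using c0 by (rule PiE_restrict)
  then have "safe (c 0) (r 0)"
    using safe0 c0 r0 unfolding c00 safe_def by (auto simp: PiE_iff)
  then have safe: "safe (c t) (r t)" for t
    by (induction t) (use step in auto)
  have "play_against G k S c r"
    unfolding play_against_def
    using safe[of 0] step[OF safe] c_Suc hist by (auto simp: safe_def)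
  then obtain t where "captured_in_round k c r t"
    using win by blast
  \<comment> \<open>The two ways of being captured: meeting at the end of round \<open>t\<close>
    contradicts \<open>safe\<close> with \<open>n = 0\<close>, and a cop stepping on the robber's
    previous vertex contradicts \<open>step\<close>.\<close>
  then obtain i where i: "i < k" and "c t i = r t \<or> (\<exists>s. t = Suc s \<and> c t i = r s)"
    unfolding captured_in_round_def by blast
  moreover have "c t i \<noteq> r t"
  proof -
    have "\<not> catches_within G k 0 (restrict (c t) {..<k}) (r t)"
      using safe[of t] unfolding safe_def by blast
    then show ?thesis using i by simp
  qed
  ultimately show False
    using step[OF safe] by auto
qed

text \<open>There are finitely many extensional placements and robber positions, so the bounds of
  the single configurations have a maximum.\<close>

lemma cops_win_uniform_bound:
  assumes "cops_win G k"
  shows "\<exists>N. \<forall>c\<in>Pi\<^sub>E {..<k} (\<lambda>_. verts G). \<forall>r\<in>verts G. catches_within G k N c r"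
proof -
  let ?C = "Pi\<^sub>E {..<k} (\<lambda>_. verts G) \<times> verts G"
  have "\<forall>p\<in>?C. \<exists>n. catches_within G k n (fst p) (snd p)"
    using cops_win_imp_catches_within[OF assms] by auto
  then obtain f where f: "\<forall>p\<in>?C. catches_within G k (f p) (fst p) (snd p)"
    by metis
  have "finite ?C"
    by (simp add: finite_PiE)
  then have "catches_within G k (Max (f ` ?C)) c r" if "(c, r) \<in> ?C" for c r
    using that f catches_within_mono[of "f (c, r)" "Max (f ` ?C)"] by (metis Max_ge finite_imageI fst_conv imageI snd_conv)
  then show ?thesis by blast
qed

section \<open>Finiteness of the cop number\<close>

text \<open>
  Existence of the cop number: each vertex gets its own cop, who walks to it and then steps
  back and forth between it and a neighbour. Once all of them have arrived, every vertex is
  occupied at any two consecutive times, so no vertex is safe for the robber.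
\<close>

lemma cops_win_card_verts:
  assumes "Digraph_Component.connected G"
  shows "cops_win G (card (verts G))"
proof -
  let ?k = "card (verts G)"
  obtain post where post: "bij_betw post {..<?k} (verts G)"
    using ex_bij_betw_nat_finite[OF finite_verts] by (auto simp: atLeast0LessThan)
  \<comment> \<open>Graph distance, as the least length of a walk.\<close>
  define d where "d u v = (LEAST n. (u, v) \<in> arcs_ends G ^^ n)" for u v
  have reach: "\<exists>n. (u, v) \<in> arcs_ends G ^^ n" if "u \<in> verts G" "v \<in> verts G" for u v
    using symmetric_connected_imp_strongly_connected[OF sym_arcs assms] that
      reachable_rtranclI[of G u v] rtrancl_imp_relpow
    unfolding strongly_connected_def by blast
  have d0: "u = v" if "u \<in> verts G" "v \<in> verts G" "d u v = 0" for u v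
    using LeastI_ex[OF reach[OF that(1,2)]] that(3) unfolding d_def by simp
  have closer: "\<exists>w\<in>cop_moves G u. d w v \<le> d u v - 1" if uv: "u \<in> verts G" "v \<in> verts G" "u \<noteq> v" for u v
  proof -
    have n: "(u, v) \<in> arcs_ends G ^^ d u v"
      using LeastI_ex[OF reach[OF uv(1,2)]] unfolding d_def .
    have "d u v \<noteq> 0" using d0 uv by blast
    then obtain m where m: "d u v = Suc m" using not0_implies_Suc by blast
    with n obtain w where w: "u \<rightarrow>\<^bsub>G\<^esub> w" "(w, v) \<in> arcs_ends G ^^ m"
      using relpow_Suc_D2 by metis
    then have "d w v \<le> m" unfolding d_def by (intro Least_le)
    with w m show ?thesis by (auto simp: cop_moves_def Let_def)
  qed
  \<comment> \<open>A cop on its post has to leave it if there is an edge, but by symmetry of the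
    arcs it is then only one step away.\<close>
  have near: "d w v \<le> 1" if "v \<in> verts G" "w \<in> cop_moves G v" for w v
  proof (cases "w = v")
    case False
    then have "v \<rightarrow>\<^bsub>G\<^esub> w" using that by (auto simp: cop_moves_def Let_def split: if_splits)
    then have "(w, v) \<in> arcs_ends G ^^ 1"
      using sym_arcs by (auto simp: symmetric_def dest: symD)
    then show ?thesis unfolding d_def by (intro Least_le)
  next
    case True
    then have "(w, v) \<in> arcs_ends G ^^ 0" by simp
    then have "d w v \<le> 0" unfolding d_def by (intro Least_le)
    then show ?thesis by simp
  qed
  \<comment> \<open>The bound with \<open>max 1\<close> also covers a cop that must leave its post;
    the last conjunct makes a cop away from its post come closer.\<close>
  define S :: "'a cop_strategy" where
    "S h i = (SOME w. w \<in> cop_moves G (fst (last h) i)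
       \<and> d w (post i) \<le> max 1 (d (fst (last h) i) (post i) - 1)
       \<and> (fst (last h) i \<noteq> post i \<longrightarrow> d w (post i) \<le> d (fst (last h) i) (post i) - 1))" for h i
  have S: "S h i \<in> cop_moves G (fst (last h) i)
       \<and> d (S h i) (post i) \<le> max 1 (d (fst (last h) i) (post i) - 1)
       \<and> (fst (last h) i \<noteq> post i \<longrightarrow> d (S h i) (post i) \<le> d (fst (last h) i) (post i) - 1)"
    if "i < ?k" "fst (last h) i \<in> verts G" for h i
    unfolding S_def
  proof (rule someI_ex, cases "fst (last h) i = post i")
    case True
    then show "\<exists>w. w \<in> cop_moves G (fst (last h) i)
       \<and> d w (post i) \<le> max 1 (d (fst (last h) i) (post i) - 1)
       \<and> (fst (last h) i \<noteq> post i \<longrightarrow> d w (post i) \<le> d (fst (last h) i) (post i) - 1)"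
      using cop_moves_nonempty near[of "post i"] that(2) by (metis all_not_in_conv max.coboundedI1)
  next
    case False
    have "post i \<in> verts G" using post that(1) by (auto simp: bij_betw_def)
    from closer[OF that(2) this False] show "\<exists>w. w \<in> cop_moves G (fst (last h) i)
       \<and> d w (post i) \<le> max 1 (d (fst (last h) i) (post i) - 1)
       \<and> (fst (last h) i \<noteq> post i \<longrightarrow> d w (post i) \<le> d (fst (last h) i) (post i) - 1)"
      by auto
  qed
  have "legal_cop_strategy G ?k S"
    unfolding legal_cop_strategy_def using S by blast
  moreover have "\<exists>t. captured_in_round ?k c r t" if play: "play_against G ?k S c r" for c r
  proof -
    have S': "c (Suc t) i \<in> verts G \<and> d (c (Suc t) i) (post i) \<le> max 1 (d (c t i) (post i) - 1)
       \<and> (c t i \<noteq> post i \<longrightarrow> d (c (Suc t) i) (post i) \<le> d (c t i) (post i) - 1)"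
      if "i < ?k" "c t i \<in> verts G" for t i
    proof -
      define h where "h = map (\<lambda>s. (c s, r s)) [0..<Suc t]"
      have "c (Suc t) = S h" using play unfolding play_against_def h_def by blast
      moreover have "fst (last h) = c t" by (simp add: h_def)
      ultimately show ?thesis
        using S[of i h] cop_moves_subset that by auto
    qed
    have cV: "c t i \<in> verts G" if "i < ?k" for t i
      by (induction t) (use play S' that in \<open>auto simp: play_against_def\<close>)
    have rV: "r t \<in> verts G" for t
    proof (induction t)
      case (Suc t)
      then show ?case using play robber_moves_subset unfolding play_against_def by blast
    qed (use play in \<open>simp add: play_against_def\<close>)
    have dist: "d (c t i) (post i) \<le> max 1 (d (c 0 i) (post i) - t)" if "i < ?k" for t i
    proof (induction t)
      case (Suc t)
      then show ?case using S'[OF that cV[OF that], of t] by arith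
    qed simp
    \<comment> \<open>The sum of all initial distances serves as a common upper bound for them; by
      then every cop is within distance 1 of its post.\<close>
    define t where "t = (\<Sum>i<?k. d (c 0 i) (post i))"
    have "r t \<in> post ` {..<?k}"
      using post rV[of t] by (simp add: bij_betw_def)
    then obtain i where i: "i < ?k" "post i = r t" by auto
    have "d (c 0 i) (post i) \<le> t"
      unfolding t_def using i(1) by (intro member_le_sum) auto
    then have "d (c t i) (post i) \<le> 1" using dist[OF i(1), of t] by simp
    \<comment> \<open>The cop whose post is \<open>r t\<close> is either there already or steps onto
      it in the next round, before the robber can move away.\<close>
    then have "c t i = r t \<or> c (Suc t) i = r t"
      using S'[OF i(1) cV[OF i(1)], of t] d0[OF cV[OF i(1)], of _ "Suc t"] rV[of t] i(2) by auto
    then have "captured_in_round ?k c r t \<or> captured_in_round ?k c r (Suc t)"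
      using i(1) unfolding captured_in_round_def by blast
    then show ?thesis by blast
  qed
  ultimately show ?thesis
    unfolding cops_win_def by blast
qed

end

section \<open>Tail events and geometric decay\<close>

lemma less_capture_time_iff:
  "enat t < capture_time k c r \<longleftrightarrow> (\<forall>s\<le>t. \<not> captured_in_round k c r s)"
proof -
  have "enat t < capture_time k c r \<longleftrightarrow> enat (Suc t) \<le> capture_time k c r"
    by (simp add: Suc_ile_eq)
  also have "\<dots> \<longleftrightarrow> (\<forall>s. captured_in_round k c r s \<longrightarrow> Suc t \<le> s)"
    by (auto simp: capture_time_def le_INF_iff)
  finally show ?thesis by (auto simp: not_less_eq_eq)
qed

text \<open>A partial sum \<open>s\<close> is at most the sum of the first \<open>N\<close> terms
  plus the shifted partial sum, which is at most \<open>q * s\<close>. Solving for \<open>s\<close>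
  bounds all partial sums.\<close>

lemma summable_of_shift_contraction:
  fixes a :: "nat \<Rightarrow> real"
  assumes nonneg: "\<And>t. 0 \<le> a t" and decay: "\<And>t. a (t + N) \<le> q * a t" and "q < 1"
  shows "summable a"
proof (rule summableI_nonneg_bounded[OF nonneg])
  fix n
  have "sum a {..<n} \<le> sum a {..<n + N}"
    by (intro sum_mono2) (auto simp: nonneg)
  also have "\<dots> = sum a {..<N} + (\<Sum>t<n. a (t + N))"
    by (induction n) (simp_all add: ac_simps)
  also have "(\<Sum>t<n. a (t + N)) \<le> q * sum a {..<n}"
    unfolding sum_distrib_left by (intro sum_mono decay)
  finally have "(1 - q) * sum a {..<n} \<le> sum a {..<N}"
    by (simp add: algebra_simps)
  then show "sum a {..<n} \<le> sum a {..<N} / (1 - q)"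
    using \<open>q < 1\<close> by (simp add: field_simps)
qed

section \<open>The random pursuit and its decomposition into finite histories\<close>

locale random_pursuit = graph G + prob_space M
  for G :: "('a, 'b) pre_digraph" (structure) and M :: "'w measure" +
  fixes k :: nat and x0 :: "nat \<Rightarrow> 'a"
    and X :: "nat \<Rightarrow> nat \<Rightarrow> 'w \<Rightarrow> 'a" and R :: "nat \<Rightarrow> 'w \<Rightarrow> 'a"
  assumes start: "\<forall>i<k. x0 i \<in> verts G"
    and walking: "random_walking_cops G k x0 M X R"
    and robber: "legal_robber G M R"
begin

definition past :: "nat \<Rightarrow> (nat \<Rightarrow> nat \<Rightarrow> 'a) \<Rightarrow> (nat \<Rightarrow> 'a) \<Rightarrow> 'w set" where
  "past t x r = {\<omega> \<in> space M. \<forall>s\<le>t. (\<forall>i<k. X s i \<omega> = x s i) \<and> R s \<omega> = r s}"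

definition past_step ::
    "nat \<Rightarrow> (nat \<Rightarrow> nat \<Rightarrow> 'a) \<Rightarrow> (nat \<Rightarrow> 'a) \<Rightarrow> (nat \<Rightarrow> 'a) \<Rightarrow> 'w set" where
  "past_step t x r y = {\<omega> \<in> space M. (\<forall>s\<le>t. (\<forall>i<k. X s i \<omega> = x s i) \<and> R s \<omega> = r s) \<and>
                          (\<forall>i<k. X (Suc t) i \<omega> = y i)}"

text \<open>The event T > t.\<close>

definition uncaught :: "nat \<Rightarrow> 'w set" where
  "uncaught t = {\<omega> \<in> space M.
     \<forall>s\<le>t. \<not> captured_in_round k (\<lambda>t i. X t i \<omega>) (\<lambda>t. R t \<omega>) s}"

text \<open>The robber is legal at every sample point, but the cops' staying on the graph follows
  from their step probabilities only almost surely (\<open>prob_inside\<close>).\<close>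

definition inside :: "nat \<Rightarrow> 'w set" where
  "inside t = {\<omega> \<in> space M. \<forall>s\<le>t. \<forall>i<k. X s i \<omega> \<in> verts G}"

definition placements :: "(nat \<Rightarrow> 'a) set" where
  "placements = Pi\<^sub>E {..<k} (\<lambda>_. verts G)"

text \<open>\<open>past t x r\<close> looks only at rounds up to \<open>t\<close> and cops below
  \<open>k\<close>. Extensional representatives make the index set finite and the events of distinct
  histories disjoint.\<close>

definition histories :: "nat \<Rightarrow> ((nat \<Rightarrow> nat \<Rightarrow> 'a) \<times> (nat \<Rightarrow> 'a)) set" where
  "histories t = Pi\<^sub>E {..t} (\<lambda>_. placements) \<times> Pi\<^sub>E {..t} (\<lambda>_. verts G)"

lemma finite_placements: "finite placements"
  by (simp add: placements_def finite_PiE)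

lemma finite_histories: "finite (histories t)"
  by (simp add: histories_def finite_PiE finite_placements)

lemma X_measurable [measurable]: "i < k \<Longrightarrow> X t i \<in> M \<rightarrow>\<^sub>M count_space UNIV"
  and R_measurable [measurable]: "R t \<in> M \<rightarrow>\<^sub>M count_space UNIV"
  using walking unfolding random_walking_cops_def by blast+

lemma prob_past_step:
  "prob (past_step t x r y) = prob (past t x r) * (\<Prod>i<k. pmf (walk_step G (x t i)) (y i))"
  using walking unfolding random_walking_cops_def past_def past_step_def by blast

lemma R_in_verts: "\<omega> \<in> space M \<Longrightarrow> R t \<omega> \<in> verts G"
proof (induction t)
  case (Suc t)
  then show ?case
    using robber robber_moves_subset unfolding legal_robber_def by blast
qed (use robber in \<open>simp add: legal_robber_def\<close>)

lemma verts_nonempty: "verts G \<noteq> {}"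
  using R_in_verts not_empty by blast

lemma past_event [measurable]: "past t x r \<in> events"
  unfolding past_def by measurable

lemma past_step_event [measurable]: "past_step t x r y \<in> events"
  unfolding past_step_def by measurable

lemma past_step_subset_past: "past_step t x r y \<subseteq> past t x r"
  unfolding past_step_def past_def by blast

lemma inside_event [measurable]: "inside t \<in> events"
proof -
  have [measurable]: "Measurable.pred M (\<lambda>\<omega>. X s i \<omega> \<in> verts G)" if "i < k" for s i
    by (rule measurable_compose[OF X_measurable[OF that]]) simp
  show ?thesis
    unfolding inside_def by measurable
qed

text \<open>The type of vertices may be uncountable, so the coincidence is split over the finitely
  many vertices that the robber can occupy.\<close>

lemma same_position_pred [measurable]:
  assumes "i < k"
  shows "Measurable.pred M (\<lambda>\<omega>. X t i \<omega> = R s \<omega>)"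
proof -
  have "{\<omega> \<in> space M. X t i \<omega> = R s \<omega>}
      = (\<Union>v\<in>verts G. {\<omega> \<in> space M. X t i \<omega> = v} \<inter> {\<omega> \<in> space M. R s \<omega> = v})"
    using R_in_verts by auto
  also have "\<dots> \<in> events"
    using assms by (intro sets.finite_UN finite_verts) measurable
  finally show ?thesis by (simp add: pred_def)
qed

lemma captured_pred [measurable]:
  "Measurable.pred M (\<lambda>\<omega>. captured_in_round k (\<lambda>t i. X t i \<omega>) (\<lambda>t. R t \<omega>) t)"
  unfolding captured_in_round_def by measurable

lemma uncaught_event [measurable]: "uncaught t \<in> events"
  unfolding uncaught_def by measurable

lemma uncaught_antimono: "s \<le> t \<Longrightarrow> uncaught t \<subseteq> uncaught s"
  unfolding uncaught_def by auto

lemma captured_in_round_past: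
  assumes "\<omega> \<in> past t x r" "s \<le> t"
  shows "captured_in_round k (\<lambda>t i. X t i \<omega>) (\<lambda>t. R t \<omega>) s \<longleftrightarrow> captured_in_round k x r s"
proof -
  have "X s i \<omega> = x s i" if "i < k" for i
    using assms that unfolding past_def by blast
  moreover have "R u \<omega> = r u" if "u \<le> s" for u
    using assms that unfolding past_def by auto
  ultimately show ?thesis
    unfolding captured_in_round_def by auto
qed

lemma past_Int_uncaught:
  assumes "captured_in_round k x r s" "s \<le> t" "s \<le> u"
  shows "past t x r \<inter> uncaught u = {}"
  using captured_in_round_past assms unfolding uncaught_def by blast

text \<open>The robber's arbitrary, possibly randomized choice enters the estimates through this
  finite partition by his legal replies.\<close>

lemma past_step_eq_UN:
  "past_step t x r y
    = (\<Union>r'\<in>robber_moves G (r t). past (Suc t) (x(Suc t := y)) (r(Suc t := r')))"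
proof
  show "past_step t x r y
    \<subseteq> (\<Union>r'\<in>robber_moves G (r t). past (Suc t) (x(Suc t := y)) (r(Suc t := r')))"
  proof
    fix \<omega> assume \<omega>: "\<omega> \<in> past_step t x r y"
    then have "R (Suc t) \<omega> \<in> robber_moves G (R t \<omega>)" "R t \<omega> = r t"
      using robber unfolding past_step_def legal_robber_def by blast+
    moreover have "\<omega> \<in> past (Suc t) (x(Suc t := y)) (r(Suc t := R (Suc t) \<omega>))"
      using \<omega> by (auto simp: past_step_def past_def le_Suc_eq)
    ultimately show
      "\<omega> \<in> (\<Union>r'\<in>robber_moves G (r t). past (Suc t) (x(Suc t := y)) (r(Suc t := r')))"
      by auto
  qed
qed (auto simp: past_step_def past_def le_Suc_eq)

lemma disjoint_past_robber_moves:
  "disjoint_family_on (\<lambda>r'. past (Suc t) x (r(Suc t := r'))) A"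
  by (auto simp: disjoint_family_on_def past_def)

lemma disjoint_past: "disjoint_family_on (\<lambda>h. past t (fst h) (snd h)) (histories t)"
proof (unfold disjoint_family_on_def, intro ballI impI, rule ccontr)
  fix g h
  assume gh: "g \<in> histories t" "h \<in> histories t" "g \<noteq> h"
    and "past t (fst g) (snd g) \<inter> past t (fst h) (snd h) \<noteq> {}"
  then obtain \<omega> where \<omega>: "\<omega> \<in> past t (fst g) (snd g)" "\<omega> \<in> past t (fst h) (snd h)" by blast
  have "fst g s i = fst h s i" if "s \<in> {..t}" "i \<in> {..<k}" for s i
    using \<omega> that unfolding past_def by auto
  then have "fst g s = fst h s" if "s \<in> {..t}" for s
    using gh that unfolding histories_def placements_def mem_Times_iff
    by (intro PiE_ext[of "fst g s" "{..<k}" "\<lambda>_. verts G"]) auto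
  moreover have "snd g s = snd h s" if "s \<in> {..t}" for s
    using \<omega> that unfolding past_def by auto
  moreover have "fst g \<in> Pi\<^sub>E {..t} (\<lambda>_. placements)" "fst h \<in> Pi\<^sub>E {..t} (\<lambda>_. placements)"
    "snd g \<in> Pi\<^sub>E {..t} (\<lambda>_. verts G)" "snd h \<in> Pi\<^sub>E {..t} (\<lambda>_. verts G)"
    using gh unfolding histories_def mem_Times_iff by blast+
  ultimately have "fst g = fst h" "snd g = snd h"
    by (metis PiE_ext)+
  then show False using gh(3) by (simp add: prod_eq_iff)
qed

lemma inside_eq_UN: "inside t = (\<Union>h\<in>histories t. past t (fst h) (snd h))"
proof
  show "inside t \<subseteq> (\<Union>h\<in>histories t. past t (fst h) (snd h))"
  proof
    fix \<omega> assume \<omega>: "\<omega> \<in> inside t"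
    let ?h = "(\<lambda>s\<in>{..t}. \<lambda>i\<in>{..<k}. X s i \<omega>, \<lambda>s\<in>{..t}. R s \<omega>)"
    have "?h \<in> histories t"
      using \<omega> R_in_verts by (auto simp: inside_def histories_def placements_def)
    moreover have "\<omega> \<in> past t (fst ?h) (snd ?h)"
      using \<omega> by (auto simp: inside_def past_def)
    ultimately show "\<omega> \<in> (\<Union>h\<in>histories t. past t (fst h) (snd h))" by blast
  qed
  show "(\<Union>h\<in>histories t. past t (fst h) (snd h)) \<subseteq> inside t"
    by (fastforce simp: inside_def histories_def placements_def past_def PiE_iff)
qed

lemma sum_walk_steps:
  assumes "c \<in> placements"
  shows "(\<Sum>y\<in>placements. \<Prod>i<k. pmf (walk_step G (c i)) (y i)) = 1"
proof -
  have "(\<Sum>v\<in>verts G. pmf (walk_step G (c i)) v) = 1" if "i < k" for i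
  proof (rule sum_pmf_eq_1[OF finite_verts])
    have "c i \<in> verts G" using assms that by (auto simp: placements_def)
    then show "set_pmf (walk_step G (c i)) \<subseteq> verts G"
      by (simp add: walk_step_def set_pmf_of_set cop_moves_nonempty finite_cop_moves cop_moves_subset)
  qed
  then show ?thesis
    unfolding placements_def
    by (subst prod_sum_PiE[symmetric, where f = "\<lambda>i. pmf (walk_step G (c i))"]) auto
qed

text \<open>By induction: split round \<open>Suc t\<close> by the history and the next joint move.
  Given any history in the graph, the moves that stay in the graph have total conditional
  probability 1, so no mass is lost.\<close>

lemma prob_inside: "prob (inside t) = 1"
proof (induction t)
  case 0
  have "inside 0 = space M"
    using walking start unfolding random_walking_cops_def inside_def by auto
  then show ?case by (simp add: prob_space)
next
  case (Suc t)
  let ?E = "\<lambda>(h, y). past_step t (fst h) (snd h) y"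
  have "inside (Suc t) = (\<Union>p\<in>histories t \<times> placements. ?E p)"
  proof
    show "inside (Suc t) \<subseteq> (\<Union>p\<in>histories t \<times> placements. ?E p)"
    proof
      fix \<omega> assume \<omega>: "\<omega> \<in> inside (Suc t)"
      then have "\<omega> \<in> inside t" by (simp add: inside_def)
      then obtain h where "h \<in> histories t" "\<omega> \<in> past t (fst h) (snd h)"
        unfolding inside_eq_UN by blast
      moreover have "(\<lambda>i\<in>{..<k}. X (Suc t) i \<omega>) \<in> placements"
        using \<omega> by (auto simp: inside_def placements_def)
      ultimately show "\<omega> \<in> (\<Union>p\<in>histories t \<times> placements. ?E p)"
        by (intro UN_I[of "(h, \<lambda>i\<in>{..<k}. X (Suc t) i \<omega>)"]) (auto simp: past_def past_step_def)
    qed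
    have "past_step t (fst h) (snd h) y \<subseteq> inside (Suc t)"
      if "h \<in> histories t" "y \<in> placements" for h y
    proof
      fix \<omega> assume \<omega>: "\<omega> \<in> past_step t (fst h) (snd h) y"
      then have "\<omega> \<in> past t (fst h) (snd h)" by (auto simp: past_def past_step_def)
      then have "\<omega> \<in> inside t" using that(1) inside_eq_UN by blast
      then show "\<omega> \<in> inside (Suc t)"
        using \<omega> that(2) by (auto simp: inside_def past_step_def placements_def PiE_iff le_Suc_eq)
    qed
    then show "(\<Union>p\<in>histories t \<times> placements. ?E p) \<subseteq> inside (Suc t)" by auto
  qed
  moreover have "disjoint_family_on ?E (histories t \<times> placements)"
  proof (unfold disjoint_family_on_def, intro ballI impI, rule ccontr)
    fix p q
    assume pq: "p \<in> histories t \<times> placements" "q \<in> histories t \<times> placements" "p \<noteq> q"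
      and "?E p \<inter> ?E q \<noteq> {}"
    then obtain \<omega> where \<omega>: "\<omega> \<in> ?E p" "\<omega> \<in> ?E q" by blast
    have "\<omega> \<in> past t (fst (fst p)) (snd (fst p))" "\<omega> \<in> past t (fst (fst q)) (snd (fst q))"
      using \<omega> by (auto simp: past_def past_step_def split_beta)
    then have "fst p = fst q"
      using pq disjoint_past[of t] unfolding disjoint_family_on_def mem_Times_iff by blast
    moreover have "snd p = snd q"
    proof (rule PiE_ext[of _ "{..<k}" "\<lambda>_. verts G"])
      show "snd p \<in> Pi\<^sub>E {..<k} (\<lambda>_. verts G)" "snd q \<in> Pi\<^sub>E {..<k} (\<lambda>_. verts G)"
        using pq unfolding placements_def mem_Times_iff by blast+
      show "snd p i = snd q i" if "i \<in> {..<k}" for i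
        using \<omega> that by (auto simp: past_step_def split_beta)
    qed
    ultimately show False using pq(3) by (simp add: prod_eq_iff)
  qed
  ultimately have "prob (inside (Suc t)) = (\<Sum>p\<in>histories t \<times> placements. prob (?E p))"
    by (auto intro!: finite_measure_finite_Union finite_histories finite_placements)
  \<comment> \<open>The multiplied-out conditional law \<open>prob_past_step\<close> separates the
    history from the next move.\<close>
  also have "\<dots> = (\<Sum>h\<in>histories t. prob (past t (fst h) (snd h)) *
      (\<Sum>y\<in>placements. \<Prod>i<k. pmf (walk_step G (fst h t i)) (y i)))"
    by (simp add: sum.cartesian_product prob_past_step sum_distrib_left split_beta)
  also have "\<dots> = (\<Sum>h\<in>histories t. prob (past t (fst h) (snd h)))"
    by (intro sum.cong) (auto simp: sum_walk_steps histories_def PiE_iff)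
  also have "\<dots> = prob (inside t)"
    unfolding inside_eq_UN
    by (intro finite_measure_finite_Union[symmetric] finite_histories disjoint_past) auto
  finally show ?case by (simp add: Suc)
qed

text \<open>Outside a null set, the finitely many histories partition the sample space.\<close>

lemma prob_eq_sum_histories:
  assumes [measurable]: "A \<in> events"
  shows "prob A = (\<Sum>h\<in>histories t. prob (A \<inter> past t (fst h) (snd h)))"
proof -
  have "AE \<omega> in M. \<omega> \<in> inside t"
    using prob_inside by (subst AE_in_set_eq_1) auto
  then have "prob A = prob (A \<inter> inside t)"
    by (intro finite_measure_eq_AE) auto
  also have "A \<inter> inside t = (\<Union>h\<in>histories t. A \<inter> past t (fst h) (snd h))"
    unfolding inside_eq_UN by blast
  also have "prob \<dots> = (\<Sum>h\<in>histories t. prob (A \<inter> past t (fst h) (snd h)))"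
  proof (intro finite_measure_finite_Union finite_histories)
    show "disjoint_family_on (\<lambda>h. A \<inter> past t (fst h) (snd h)) (histories t)"
      using disjoint_past[of t] unfolding disjoint_family_on_def by blast
  qed auto
  finally show ?thesis .
qed

section \<open>A lower bound for the probability of capture\<close>

text \<open>A cop has at most |V| possible moves, so each is taken with probability at least 1/|V|;
  by independence this bounds the probability of any prescribed legal joint move from below.\<close>

definition hit :: real where
  "hit = (1 / real (card (verts G))) ^ k"

lemma card_verts_pos: "0 < card (verts G)"
  using verts_nonempty finite_verts by (simp add: card_gt_0_iff)

lemma hit_pos: "0 < hit"
  using card_verts_pos by (simp add: hit_def)

lemma hit_le_1: "hit \<le> 1"
  using card_verts_pos unfolding hit_def by (intro power_le_one) auto

lemma hit_le_walk_steps: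
  assumes "\<forall>i<k. c i \<in> verts G" and "y \<in> Pi\<^sub>E {..<k} (\<lambda>i. cop_moves G (c i))"
  shows "hit \<le> (\<Prod>i<k. pmf (walk_step G (c i)) (y i))"
proof -
  have "1 / real (card (verts G)) \<le> pmf (walk_step G (c i)) (y i)" if "i < k" for i
  proof -
    have V: "c i \<in> verts G" using assms(1) that by blast
    have "0 < card (cop_moves G (c i))"
      using cop_moves_nonempty finite_cop_moves[OF V] by (simp add: card_gt_0_iff)
    moreover have "card (cop_moves G (c i)) \<le> card (verts G)"
      by (intro card_mono finite_verts cop_moves_subset V)
    moreover have "y i \<in> cop_moves G (c i)" using assms(2) that by auto
    ultimately show ?thesis
      by (simp add: walk_step_def pmf_of_set cop_moves_nonempty finite_cop_moves[OF V] frac_le)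
  qed
  then have "(\<Prod>i<k. 1 / real (card (verts G))) \<le> (\<Prod>i<k. pmf (walk_step G (c i)) (y i))"
    by (intro prod_mono) auto
  then show ?thesis by (simp add: hit_def)
qed

text \<open>By induction on \<open>n\<close>, for all pasts at once: the cops make the winning joint
  move with conditional probability at least \<open>hit\<close>; then either they have caught the
  robber, or the induction hypothesis applies to the past extended by each of his replies.\<close>

lemma capture_prob:
  assumes "catches_within G k n (x t) (r t)" and "\<forall>i<k. x t i \<in> verts G" and "r t \<in> verts G"
  shows "hit ^ n * prob (past t x r) \<le> prob (past t x r - uncaught (t + n))"
  using assms
proof (induction n arbitrary: t x r)
  case (Suc n)
  show ?case
  proof (cases "\<exists>i<k. x t i = r t")
    case True
    then have "past t x r \<inter> uncaught (t + Suc n) = {}"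
      by (intro past_Int_uncaught[of _ _ t]) (auto simp: captured_in_round_def)
    then have "past t x r - uncaught (t + Suc n) = past t x r" by blast
    moreover have "hit ^ Suc n \<le> 1"
      using hit_pos hit_le_1 by (intro power_le_one) auto
    ultimately show ?thesis
      by (metis measure_nonneg mult_left_le_one_le hit_pos less_imp_le zero_le_power)
  next
    case False
    then obtain y where y: "y \<in> Pi\<^sub>E {..<k} (\<lambda>i. cop_moves G (x t i))"
      and y_wins: "(\<exists>i<k. y i = r t) \<or> (\<forall>r'\<in>robber_moves G (r t). catches_within G k n y r')"
      using Suc.prems(1) by auto
    let ?E = "past_step t x r y"
    have "hit ^ Suc n * prob (past t x r) = hit ^ n * (prob (past t x r) * hit)"
      by simp
    also have "\<dots> \<le> hit ^ n * prob ?E"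
      unfolding prob_past_step using hit_le_walk_steps[OF Suc.prems(2) y] hit_pos
      by (intro mult_left_mono) auto
    also have "\<dots> \<le> prob (past t x r - uncaught (t + Suc n))"
      using y_wins
    proof
      assume "\<exists>i<k. y i = r t"
      then have caught: "captured_in_round k (\<lambda>t i. X t i \<omega>) (\<lambda>t. R t \<omega>) (Suc t)"
        if "\<omega> \<in> ?E" for \<omega>
        using that unfolding past_step_def captured_in_round_def by auto
      have "\<omega> \<notin> uncaught (t + Suc n)" if "\<omega> \<in> ?E" for \<omega>
        using caught[OF that] unfolding uncaught_def by (auto intro!: exI[of _ "Suc t"])
      then have "?E \<subseteq> past t x r - uncaught (t + Suc n)"
        using past_step_subset_past by blast
      then have "prob ?E \<le> prob (past t x r - uncaught (t + Suc n))"
        by (intro finite_measure_mono) auto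
      moreover have "hit ^ n * prob ?E \<le> prob ?E"
        using hit_pos hit_le_1 by (intro mult_left_le_one_le power_le_one) auto
      ultimately show ?thesis by linarith
    next
      assume win: "\<forall>r'\<in>robber_moves G (r t). catches_within G k n y r'"
      let ?F = "\<lambda>r'. past (Suc t) (x(Suc t := y)) (r(Suc t := r'))"
      let ?U = "uncaught (Suc t + n)"
      have fin: "finite (robber_moves G (r t))"
        using robber_moves_subset[OF Suc.prems(3)] finite_verts finite_subset by blast
      have yV: "\<forall>i<k. y i \<in> verts G"
        using y Suc.prems(2) cop_moves_subset by blast
      have E: "?E = (\<Union>r'\<in>robber_moves G (r t). ?F r')"
        by (rule past_step_eq_UN)
      have "hit ^ n * prob ?E = (\<Sum>r'\<in>robber_moves G (r t). hit ^ n * prob (?F r'))"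
        unfolding E sum_distrib_left[symmetric]
        by (subst finite_measure_finite_Union[OF fin _ disjoint_past_robber_moves]) auto
      \<comment> \<open>Each extended past ends at time \<open>Suc t\<close> with \<open>n\<close>
        rounds left, so the horizon \<open>Suc t + n\<close> is the original
        \<open>t + Suc n\<close>.\<close>
      also have "\<dots> \<le> (\<Sum>r'\<in>robber_moves G (r t). prob (?F r' - ?U))"
      proof (intro sum_mono Suc.IH)
        fix r' assume r': "r' \<in> robber_moves G (r t)"
        show "catches_within G k n ((x(Suc t := y)) (Suc t)) ((r(Suc t := r')) (Suc t))"
          using win r' by simp
        show "\<forall>i<k. (x(Suc t := y)) (Suc t) i \<in> verts G"
          using yV by simp
        show "(r(Suc t := r')) (Suc t) \<in> verts G"
          using r' robber_moves_subset[OF Suc.prems(3)] by auto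
      qed
      also have "\<dots> = prob (\<Union>r'\<in>robber_moves G (r t). ?F r' - ?U)"
        using disjoint_past_robber_moves[of t "x(Suc t := y)" r "robber_moves G (r t)"]
        by (intro finite_measure_finite_Union[symmetric] fin) (auto simp: disjoint_family_on_def)
      also have "\<dots> = prob (?E - ?U)"
        unfolding E by (rule arg_cong[where f = prob]) blast
      also have "\<dots> \<le> prob (past t x r - uncaught (t + Suc n))"
        by (intro finite_measure_mono) (auto simp: past_def past_step_def)
      finally show ?thesis .
    qed
    finally show ?thesis .
  qed
next
  case 0
  then have "past t x r \<inter> uncaught t = {}"
    by (intro past_Int_uncaught[of _ _ t]) (auto simp: captured_in_round_def)
  then have "past t x r - uncaught (t + 0) = past t x r" by auto
  then show ?case by simp
qed

section \<open>Geometric decay of survival and the expectation\<close>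

text \<open>The inequality is checked on each history and summed. A history with a capture
  contributes 0 to both sides; any other lies in \<open>uncaught t\<close>, and
  \<open>capture_prob\<close> removes at least the fraction \<open>hit ^ N\<close> of it.\<close>

lemma uncaught_decay:
  assumes "\<And>c r. c \<in> placements \<Longrightarrow> r \<in> verts G \<Longrightarrow> catches_within G k N c r"
  shows "prob (uncaught (t + N)) \<le> (1 - hit ^ N) * prob (uncaught t)"
proof -
  have "prob (uncaught (t + N) \<inter> past t x r) \<le> (1 - hit ^ N) * prob (uncaught t \<inter> past t x r)"
    if h: "(x, r) \<in> histories t" for x r
  proof (cases "\<exists>s\<le>t. captured_in_round k x r s")
    case True
    then have "uncaught t \<inter> past t x r = {}"
      using past_Int_uncaught by blast
    moreover have "uncaught (t + N) \<subseteq> uncaught t"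
      by (rule uncaught_antimono) simp
    ultimately have "uncaught (t + N) \<inter> past t x r = {}" "uncaught t \<inter> past t x r = {}"
      by blast+
    then show ?thesis by simp
  next
    case False
    then have "past t x r \<subseteq> uncaught t"
      using captured_in_round_past unfolding uncaught_def by (auto simp: past_def)
    then have "uncaught t \<inter> past t x r = past t x r" by blast
    moreover have "hit ^ N * prob (past t x r) \<le> prob (past t x r - uncaught (t + N))"
      using h assms by (intro capture_prob) (auto simp: histories_def placements_def PiE_iff)
    moreover have "prob (past t x r - uncaught (t + N))
        = prob (past t x r) - prob (uncaught (t + N) \<inter> past t x r)"
      by (simp add: finite_measure_Diff' Int_commute)
    ultimately show ?thesis by (simp add: algebra_simps)
  qed
  then show ?thesis
    unfolding prob_eq_sum_histories[OF uncaught_event, of _ t] sum_distrib_left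
    by (intro sum_mono) auto
qed

text \<open>The index set of the infimum depends on the sample point. Giving rounds without capture
  the value \<open>\<top>\<close> turns it into an infimum over all rounds, a countable infimum of
  measurable functions.\<close>

lemma capture_time_measurable:
  "(\<lambda>\<omega>. capture_time k (\<lambda>t i. X t i \<omega>) (\<lambda>t. R t \<omega>)) \<in> M \<rightarrow>\<^sub>M count_space UNIV"
proof -
  have "capture_time k c r = (INF t. if captured_in_round k c r t then enat t else \<top>)"
    for c :: "nat \<Rightarrow> nat \<Rightarrow> 'a" and r
    unfolding capture_time_def
  proof (rule antisym)
    show "(INF t\<in>{t. captured_in_round k c r t}. enat t)
        \<le> (INF t. if captured_in_round k c r t then enat t else \<top>)"
      by (intro INF_greatest) (simp add: INF_lower)
    show "(INF t. if captured_in_round k c r t then enat t else \<top>)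
        \<le> (INF t\<in>{t. captured_in_round k c r t}. enat t)"
      by (rule INF_mono) force
  qed
  then show ?thesis by (simp only:) measurable
qed

lemma capture_time_integral_finite:
  assumes "cops_win G k"
  shows "(\<integral>\<^sup>+\<omega>. ennreal_of_enat
            (capture_time k (\<lambda>t i. X t i \<omega>) (\<lambda>t. R t \<omega>)) \<partial>M) < \<infinity>"
proof -
  obtain N where N: "\<And>c r. c \<in> placements \<Longrightarrow> r \<in> verts G \<Longrightarrow> catches_within G k N c r"
    using cops_win_uniform_bound[OF assms] unfolding placements_def by blast
  have "summable (\<lambda>t. prob (uncaught t))"
    using uncaught_decay[OF N] hit_pos
    by (intro summable_of_shift_contraction[where N = N and q = "1 - hit ^ N"]) auto
  then have "(\<Sum>t. ennreal (prob (uncaught t))) \<noteq> \<top>"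
    by (intro ennreal_suminf_neq_top) auto
  \<comment> \<open>The tail-sum formula: the expectation of T is the sum over t of the
    probabilities of T > t.\<close>
  moreover have "(\<integral>\<^sup>+\<omega>. ennreal_of_enat
      (capture_time k (\<lambda>t i. X t i \<omega>) (\<lambda>t. R t \<omega>)) \<partial>M) = (\<Sum>t. ennreal (prob (uncaught t)))"
    by (simp add: nn_integral_enat_function[OF capture_time_measurable] less_capture_time_iff
        uncaught_def[symmetric] emeasure_eq_measure)
  ultimately show ?thesis by (simp add: less_top)
qed

end

theorem theorem6p1:
  fixes G :: "('a, 'b) pre_digraph"
    and x0 :: "nat \<Rightarrow> 'a"
    and M :: "'w measure"
    and X :: "nat \<Rightarrow> nat \<Rightarrow> 'w \<Rightarrow> 'a"
    and R :: "nat \<Rightarrow> 'w \<Rightarrow> 'a"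
  assumes "graph G"
    and "Digraph_Component.connected G"
    and "\<forall>i < cop_number G. x0 i \<in> verts G"
    and "prob_space M"
    and "random_walking_cops G (cop_number G) x0 M X R"
    and "legal_robber G M R"
  shows "(\<integral>\<^sup>+\<omega>. ennreal_of_enat
            (capture_time (cop_number G) (\<lambda>t i. X t i \<omega>) (\<lambda>t. R t \<omega>)) \<partial>M) < \<infinity>"
proof -
  interpret random_pursuit G M "cop_number G" x0 X R
    using assms by (intro random_pursuit.intro random_pursuit_axioms.intro)
  \<comment> \<open>The least number of winning cops itself wins because some number does;
    connectedness is used for that.\<close>
  have "cops_win G (cop_number G)"
    unfolding cop_number_def by (rule LeastI) (rule cops_win_card_verts[OF assms(2)])
  then show ?thesis
    by (rule capture_time_integral_finite)
qed

end
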